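(* For every $k\in\mathbb N$ there exists no measure $k$-reflective real planar $C^3$-smooth germ of pseudo-billiard with an odd number of skew reflection laws.
   Context: Let $L\subset\mathbb R^2$ be a line and $A_-,A_0,A_+\in\mathbb R^2$ with $A_0\in L$, $A_\pm\notin L$ and the lines $A_-A_0$, $A_0A_+$ symmetric with respect to $L$; the triple satisfies the usual reflection law with respect to $L$ if $A_-,A_+$ lie on the same side of $L$, and the skew one otherwise. A germ of real planar pseudo-billiard is a collection of germs of smooth curves $(a_j,A_j)$, $j=1,\dots,k$, each with a prescribed reflection law (usual or skew), such that $A_1\dots A_k$ is a $k$-periodic orbit, where a $k$-periodic orbit is a $k$-gon $A_1'\dots A_k'$, $A_j'\in a_j$ (indices mod $k$), with $A_j'\ne A_{j\pm1}'$, $A_j'A_{j\pm1}'\ne T_{A_j'}a_j$, the lines $A_j'A_{j\pm1}'$ symmetric with respect to $T_{A_j'}a_j$ and the triple $A_{j-1}',A_j',A_{j+1}'$ satisfying the law prescribed for $a_j$. It is measure $k$-reflective if, within the set of $k$-gons satisfying these conditions at all vertices with $j\neq1,k$, the subset of $k$-periodic orbits has positive two-dimensional Lebesgue measure. *)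

theory Defs
  imports "HOL-Analysis.Analysis"
begin

text \<open>Points of the plane are vectors of type real^2.
  Vertices/curves are indexed by j in {0..<k} (0-based); neighbours are taken mod k.\<close>

definition det2 :: "real^2 \<Rightarrow> real^2 \<Rightarrow> real" where
  "det2 u w = u$1 * w$2 - u$2 * w$1"

text \<open>Reflection of a direction w with respect to a line with direction v.\<close>
definition reflect_dir :: "real^2 \<Rightarrow> real^2 \<Rightarrow> real^2" where
  "reflect_dir v w = (2 * (w \<bullet> v) / (v \<bullet> v)) *\<^sub>R v - w"

text \<open>C^3 smoothness of a parametrized planar curve on a set S.\<close>
definition C3_on :: "real set \<Rightarrow> (real \<Rightarrow> real^2) \<Rightarrow> bool" where
  "C3_on S \<gamma> \<longleftrightarrow> (\<exists>\<gamma>1 \<gamma>2 \<gamma>3.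
      (\<forall>t\<in>S. (\<gamma> has_vector_derivative \<gamma>1 t) (at t)) \<and>
      (\<forall>t\<in>S. (\<gamma>1 has_vector_derivative \<gamma>2 t) (at t)) \<and>
      (\<forall>t\<in>S. (\<gamma>2 has_vector_derivative \<gamma>3 t) (at t)) \<and>
      continuous_on S \<gamma>3)"

text \<open>A germ at gamma 0 of a regular C^3 curve, represented by a parametrization
  which is C^3 near 0 with nonzero velocity at 0.\<close>
definition curve_germ :: "(real \<Rightarrow> real^2) \<Rightarrow> bool" where
  "curve_germ \<gamma> \<longleftrightarrow> (\<exists>\<epsilon>>0. C3_on {-\<epsilon><..<\<epsilon>} \<gamma>) \<and> vector_derivative \<gamma> (at 0) \<noteq> 0"

text \<open>Reflection condition at vertex P of a curve with tangent direction v, with neighbouring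
  vertices Qm, Qp; skew = True for the skew law, False for the usual one.\<close>
definition refl_law :: "bool \<Rightarrow> real^2 \<Rightarrow> real^2 \<Rightarrow> real^2 \<Rightarrow> real^2 \<Rightarrow> bool" where
  "refl_law skew v P Qm Qp \<longleftrightarrow>
     P \<noteq> Qm \<and> P \<noteq> Qp \<and>
     det2 v (Qm - P) \<noteq> 0 \<and> det2 v (Qp - P) \<noteq> 0 \<and>
     det2 (reflect_dir v (Qm - P)) (Qp - P) = 0 \<and>
     (if skew then det2 v (Qm - P) * det2 v (Qp - P) < 0
      else det2 v (Qm - P) * det2 v (Qp - P) > 0)"

text \<open>The reflection condition at vertex j of the k-gon with vertices gamma i (t i).\<close>
definition vertex_ok :: "nat \<Rightarrow> (nat \<Rightarrow> real \<Rightarrow> real^2) \<Rightarrow> (nat \<Rightarrow> bool) \<Rightarrow> (nat \<Rightarrow> real) \<Rightarrow> nat \<Rightarrow> bool" where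
  "vertex_ok k \<gamma> skew t j \<longleftrightarrow>
     refl_law (skew j) (vector_derivative (\<gamma> j) (at (t j))) (\<gamma> j (t j))
       (\<gamma> ((j + k - 1) mod k) (t ((j + k - 1) mod k)))
       (\<gamma> ((j + 1) mod k) (t ((j + 1) mod k)))"

definition periodic_orbit :: "nat \<Rightarrow> (nat \<Rightarrow> real \<Rightarrow> real^2) \<Rightarrow> (nat \<Rightarrow> bool) \<Rightarrow> (nat \<Rightarrow> real) \<Rightarrow> bool" where
  "periodic_orbit k \<gamma> skew t \<longleftrightarrow> (\<forall>j<k. vertex_ok k \<gamma> skew t j)"

text \<open>A germ of real planar C^3 pseudo-billiard: germs of regular C^3 curves a_j = gamma j at
  A_j = gamma j 0 with laws skew j, such that A_0 ... A_(k-1) is a k-periodic orbit.\<close>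
definition pseudo_billiard :: "nat \<Rightarrow> (nat \<Rightarrow> real \<Rightarrow> real^2) \<Rightarrow> (nat \<Rightarrow> bool) \<Rightarrow> bool" where
  "pseudo_billiard k \<gamma> skew \<longleftrightarrow>
     (\<forall>j<k. curve_germ (\<gamma> j)) \<and> periodic_orbit k \<gamma> skew (\<lambda>_. 0)"

text \<open>Measure k-reflectivity (germ version): for every representative (parameters restricted
  to (-eps,eps)), the set of k-periodic orbits, inside the two-dimensional family of k-gons
  parametrized by the positions (t 0, t 1) of the first two vertices, has positive
  two-dimensional Lebesgue (outer) measure, i.e. is not a Lebesgue null set.\<close>
definition measure_reflective :: "nat \<Rightarrow> (nat \<Rightarrow> real \<Rightarrow> real^2) \<Rightarrow> (nat \<Rightarrow> bool) \<Rightarrow> bool" where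
  "measure_reflective k \<gamma> skew \<longleftrightarrow>
     (\<forall>\<epsilon>>0. (\<lambda>t. (t 0, t 1)) ` {t. (\<forall>j<k. t j \<in> {-\<epsilon><..<\<epsilon>}) \<and> periodic_orbit k \<gamma> skew t}
               \<notin> null_sets (lebesgue :: (real \<times> real) measure))"

end

theory Submission
  imports Defs
begin

text \<open>Parametrize polygons by the curve parameters \<open>t j\<close> of their vertices. Near a periodic
  orbit, the reflection law at vertex \<open>j\<close> is an equation in \<open>t (j - 1)\<close>, \<open>t j\<close>, \<open>t (j + 1)\<close>, so
  the increments \<open>\<Delta>\<close> of nearby periodic orbits satisfy, up to \<open>o(|\<Delta>|)\<close>, the cyclic recurrence
  \<open>a j * \<Delta> (j - 1) + b j * \<Delta> j + c j * \<Delta> (j + 1) = 0\<close>. A computation with reflections shows that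
  \<open>a j * c j\<close> is a product of two side determinants at the neighbouring vertices; regrouping by
  vertices, \<open>\<Prod>j. a j * c j\<close> has the sign of \<open>(-1) ^ (number of skew laws)\<close>. When that number is
  odd, the monodromy of the recurrence has determinant \<open>\<Prod>j. a j / c j < 0\<close>, so it is not the
  identity and yields a nonzero linear form that nearly vanishes on \<open>(\<Delta> 0, \<Delta> 1)\<close>. Hence the set
  of pairs \<open>(t 0, t 1)\<close> of periodic orbits is tangent at each of its points to a line, and a
  countable covering by Lipschitz graphs shows that it is a Lebesgue null set.\<close>

section \<open>Negligible sets tangent to hyperplanes\<close>

lemma norm_hyperplane_projection_lower_bound:
  fixes q d :: "'a::real_inner"
  assumes "0 \<le> \<theta>" "\<theta> < norm q" "\<bar>q \<bullet> d\<bar> \<le> \<theta> * norm d"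
  shows "sqrt (1 - \<theta>\<^sup>2 / (q \<bullet> q)) * norm d \<le> norm (d - (q \<bullet> d / (q \<bullet> q)) *\<^sub>R q)"
proof -
  define \<mu> where "\<mu> = (q \<bullet> d) / (q \<bullet> q)"
  have q: "q \<bullet> q > 0"
    using assms by auto
  have "(norm (d - \<mu> *\<^sub>R q))\<^sup>2 = d \<bullet> d - 2 * \<mu> * (q \<bullet> d) + \<mu>\<^sup>2 * (q \<bullet> q)"
    unfolding power2_norm_eq_inner
    by (simp add: inner_diff_left inner_diff_right inner_commute power2_eq_square algebra_simps)
  also have "\<dots> = (norm d)\<^sup>2 - (q \<bullet> d)\<^sup>2 / (q \<bullet> q)"
  proof -
    have "\<mu>\<^sup>2 * (q \<bullet> q) = \<mu> * (q \<bullet> d)" "\<mu> * (q \<bullet> d) = (q \<bullet> d)\<^sup>2 / (q \<bullet> q)"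
      using q by (simp_all add: \<mu>_def power2_eq_square)
    then show ?thesis
      by (simp add: power2_norm_eq_inner)
  qed
  finally have square: "(norm (d - \<mu> *\<^sub>R q))\<^sup>2 = (norm d)\<^sup>2 - (q \<bullet> d)\<^sup>2 / (q \<bullet> q)" .
  have "(q \<bullet> d)\<^sup>2 / (q \<bullet> q) \<le> \<theta>\<^sup>2 / (q \<bullet> q) * (norm d)\<^sup>2"
  proof -
    have "(q \<bullet> d)\<^sup>2 \<le> (\<theta> * norm d)\<^sup>2"
      using assms(3) by (metis abs_ge_zero power2_abs power_mono)
    then show ?thesis
      using q by (simp add: divide_right_mono power_mult_distrib)
  qed
  then have "(1 - \<theta>\<^sup>2 / (q \<bullet> q)) * (norm d)\<^sup>2 \<le> (norm (d - \<mu> *\<^sub>R q))\<^sup>2"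
    unfolding square by (simp add: algebra_simps)
  then show ?thesis
    unfolding \<mu>_def[symmetric] using real_sqrt_le_mono by (fastforce simp: real_sqrt_mult)
qed

text \<open>A set whose difference vectors all stay in a cone around the hyperplane \<open>q\<^sup>\<bottom>\<close> is the
  Lipschitz graph of a function on (a part of) that hyperplane.\<close>

lemma negligible_if_differences_near_hyperplane:
  fixes A :: "'a::euclidean_space set"
  assumes "0 \<le> \<theta>" "\<theta> < norm q"
    and near: "\<And>x y. x \<in> A \<Longrightarrow> y \<in> A \<Longrightarrow> \<bar>q \<bullet> (x - y)\<bar> \<le> \<theta> * norm (x - y)"
  shows "negligible A"
proof -
  define P where "P x = x - (q \<bullet> x / (q \<bullet> q)) *\<^sub>R q" for x
  define c where "c = sqrt (1 - \<theta>\<^sup>2 / (q \<bullet> q))"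
  have q: "q \<bullet> q > 0"
    using assms by auto
  have "\<theta>\<^sup>2 < (norm q)\<^sup>2"
    using assms by (simp add: power_strict_mono)
  then have "c > 0"
    using q by (simp add: c_def power2_norm_eq_inner)
  have P_diff: "P x - P y = P (x - y)" for x y
    by (simp add: P_def inner_diff_right scaleR_diff_left diff_divide_distrib)
  have P_bound: "norm (x - y) \<le> 1 / c * norm (P x - P y)" if "x \<in> A" "y \<in> A" for x y
    using norm_hyperplane_projection_lower_bound[OF assms(1,2) near[OF that]] \<open>c > 0\<close>
    unfolding P_diff by (simp add: P_def c_def field_simps)
  then have inj: "inj_on P A"
    by (fastforce intro: inj_onI)
  have "P ` A \<subseteq> {x. q \<bullet> x = 0}"
    using q by (auto simp: P_def inner_diff_right)
  then have "negligible (P ` A)"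
    using q negligible_hyperplane[of q 0] negligible_subset by auto
  then have "negligible (inv_into A P ` P ` A)"
  proof (rule negligible_locally_Lipschitz_image[OF order_refl])
    fix x assume "x \<in> P ` A"
    then show "\<exists>T B. open T \<and> x \<in> T \<and>
        (\<forall>y\<in>P ` A \<inter> T. norm (inv_into A P y - inv_into A P x) \<le> B * norm (y - x))"
      using P_bound inj by (intro exI[of _ UNIV] exI[of _ "1 / c"]) auto
  qed
  then show ?thesis
    using inj by simp
qed

lemma negligible_image_if_near_direction:
  fixes f :: "'a \<Rightarrow> 'b::euclidean_space"
  assumes "\<And>x. x \<in> T \<Longrightarrow> \<exists>q. norm q = 1 \<and> norm (q - d) < 1/8 \<and>
      (\<forall>y\<in>T. \<bar>q \<bullet> (f y - f x)\<bar> \<le> 1/2 * norm (f y - f x))"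
  shows "negligible (f ` T)"
proof (cases "T = {}")
  case False
  then obtain q where "norm q = 1" "norm (q - d) < 1/8"
    using assms by blast
  then have "5/8 < norm d"
    using norm_triangle_ineq2[of q d] by linarith
  then show ?thesis
  proof (rule negligible_if_differences_near_hyperplane[rotated])
    fix v w assume "v \<in> f ` T" "w \<in> f ` T"
    then obtain q where "norm (q - d) < 1/8" and q: "\<bar>q \<bullet> (v - w)\<bar> \<le> 1/2 * norm (v - w)"
      using assms by blast
    have "norm (d - q) * norm (v - w) \<le> 1/8 * norm (v - w)"
      using \<open>norm (q - d) < 1/8\<close> by (intro mult_right_mono) (auto simp: norm_minus_commute)
    then have "\<bar>(d - q) \<bullet> (v - w)\<bar> \<le> 1/8 * norm (v - w)"
      using Cauchy_Schwarz_ineq2[of "d - q" "v - w"] by linarith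
    with q show "\<bar>d \<bullet> (v - w)\<bar> \<le> 5/8 * norm (v - w)"
      unfolding inner_diff_left by linarith
  qed simp
qed simp

text \<open>Group the points by a basic open set on which the tangency estimate holds and by a direction
  from a countable dense set close to the normal; each group is negligible by the previous lemma.\<close>

lemma negligible_image_if_tangent_to_hyperplanes:
  fixes f :: "'a::second_countable_topology \<Rightarrow> 'b::euclidean_space"
  assumes tangent: "\<And>x. x \<in> S \<Longrightarrow> \<exists>q. q \<noteq> 0 \<and> (\<forall>\<eta>>0. \<exists>U. open U \<and> x \<in> U \<and>
      (\<forall>y\<in>S \<inter> U. \<bar>q \<bullet> (f y - f x)\<bar> \<le> \<eta> * norm (f y - f x)))"
  shows "negligible (f ` S)"
proof -
  obtain \<B> :: "'a set set" where "countable \<B>" and \<B>: "topological_basis \<B>"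
    using ex_countable_basis by blast
  obtain D :: "'b set" where "countable D" and D: "\<And>X. open X \<Longrightarrow> X \<noteq> {} \<Longrightarrow> \<exists>d\<in>D. d \<in> X"
    using countable_dense_setE by blast
  define G where "G b d = {x \<in> S \<inter> b. \<exists>q. norm q = 1 \<and> norm (q - d) < 1/8 \<and>
      (\<forall>y\<in>S \<inter> b. \<bar>q \<bullet> (f y - f x)\<bar> \<le> 1/2 * norm (f y - f x))}" for b d
  have "f ` S \<subseteq> (\<Union>(b, d)\<in>\<B> \<times> D. f ` G b d)"
  proof
    fix z assume "z \<in> f ` S"
    then obtain x where x: "x \<in> S" "z = f x" by blast
    obtain q where "q \<noteq> 0" and q: "\<And>\<eta>. \<eta> > 0 \<Longrightarrow> \<exists>U. open U \<and> x \<in> U \<and>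
        (\<forall>y\<in>S \<inter> U. \<bar>q \<bullet> (f y - f x)\<bar> \<le> \<eta> * norm (f y - f x))"
      using tangent[OF x(1)] by blast
    then obtain U where "open U" "x \<in> U"
      and U: "\<And>y. y \<in> S \<inter> U \<Longrightarrow> \<bar>q \<bullet> (f y - f x)\<bar> \<le> norm q / 2 * norm (f y - f x)"
      by (metis half_gt_zero zero_less_norm_iff)
    obtain b where b: "b \<in> \<B>" "x \<in> b" "b \<subseteq> U"
      using topological_basisE[OF \<B> \<open>open U\<close> \<open>x \<in> U\<close>] by blast
    define u where "u = q /\<^sub>R norm q"
    obtain d where d: "d \<in> D" "d \<in> ball u (1/8)"
      using D[of "ball u (1/8)"] by auto
    have "\<bar>u \<bullet> (f y - f x)\<bar> \<le> 1/2 * norm (f y - f x)" if "y \<in> S \<inter> b" for y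
    proof -
      have "\<bar>u \<bullet> (f y - f x)\<bar> = \<bar>q \<bullet> (f y - f x)\<bar> / norm q"
        by (simp add: u_def abs_mult divide_inverse_commute)
      also have "\<dots> \<le> norm q / 2 * norm (f y - f x) / norm q"
        using U[of y] that b(3) by (intro divide_right_mono) auto
      finally show ?thesis
        using \<open>q \<noteq> 0\<close> by simp
    qed
    moreover have "norm u = 1" "norm (u - d) < 1/8"
      using \<open>q \<noteq> 0\<close> d(2) by (auto simp: u_def dist_norm norm_minus_commute)
    ultimately have "x \<in> G b d"
      using x b by (auto simp: G_def)
    then show "z \<in> (\<Union>(b, d)\<in>\<B> \<times> D. f ` G b d)"
      using b d x by blast
  qed
  moreover have "negligible (f ` G b d)" for b d
    by (rule negligible_image_if_near_direction) (auto simp: G_def)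
  ultimately show ?thesis
    using \<open>countable \<B>\<close> \<open>countable D\<close>
    by (metis (mono_tags, lifting) negligible_subset negligible_countable_Union countable_SIGMA
        countable_image case_prod_beta imageE)
qed

section \<open>Cyclic three-term recurrences\<close>

definition cyclic_pred :: "nat \<Rightarrow> nat \<Rightarrow> nat" where
  "cyclic_pred k j = (j + k - 1) mod k"

definition cyclic_succ :: "nat \<Rightarrow> nat \<Rightarrow> nat" where
  "cyclic_succ k j = (j + 1) mod k"

lemma cyclic_pred_less: "0 < k \<Longrightarrow> cyclic_pred k j < k"
  and cyclic_succ_less: "0 < k \<Longrightarrow> cyclic_succ k j < k"
  by (simp_all add: cyclic_pred_def cyclic_succ_def)

lemma cyclic_pred_Suc_mod:
  assumes "0 < k"
  shows "cyclic_pred k (Suc m mod k) = m mod k"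
proof -
  obtain n where k: "k = Suc n"
    using assms gr0_implies_Suc by blast
  have "cyclic_pred k (Suc m mod k) = (Suc m mod k + n) mod k"
    by (simp add: cyclic_pred_def k)
  also have "\<dots> = (m + k) mod k"
    by (simp add: mod_add_left_eq k)
  finally show ?thesis
    by simp
qed

lemma cyclic_pred_succ: "j < k \<Longrightarrow> cyclic_pred k (cyclic_succ k j) = j"
  using cyclic_pred_Suc_mod[of k j] by (simp add: cyclic_succ_def)

lemma cyclic_succ_pred: "j < k \<Longrightarrow> cyclic_succ k (cyclic_pred k j) = j"
  by (simp add: cyclic_pred_def cyclic_succ_def mod_Suc_eq)

lemma cyclic_neighbours_le_sum:
  fixes x :: "nat \<Rightarrow> real"
  assumes "i < k"
  shows "\<bar>x (cyclic_pred k i)\<bar> + \<bar>x i\<bar> + \<bar>x (cyclic_succ k i)\<bar> \<le> 3 * (\<Sum>j<k. \<bar>x j\<bar>)"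
proof -
  have "\<bar>x j\<bar> \<le> (\<Sum>j<k. \<bar>x j\<bar>)" if "j < k" for j
    using that by (intro member_le_sum) auto
  then show ?thesis
    using assms cyclic_pred_less[of k i] cyclic_succ_less[of k i]
    by (smt (verit) gr_implies_not_zero not_gr_zero)
qed

lemma prod_cyclic_succ:
  "(\<Prod>j<k. g (cyclic_succ k j)) = (\<Prod>j<k. g j)"
  by (rule prod.reindex_bij_witness[where i="cyclic_pred k" and j="cyclic_succ k"])
    (auto simp: cyclic_pred_succ cyclic_succ_pred cyclic_pred_less cyclic_succ_less)

lemma prod_cyclic_pred:
  "(\<Prod>j<k. g (cyclic_pred k j)) = (\<Prod>j<k. g j)"
  by (rule prod.reindex_bij_witness[where i="cyclic_succ k" and j="cyclic_pred k"])
    (auto simp: cyclic_pred_succ cyclic_succ_pred cyclic_pred_less cyclic_succ_less)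

definition cyclic_residual ::
    "nat \<Rightarrow> (nat \<Rightarrow> real) \<Rightarrow> (nat \<Rightarrow> real) \<Rightarrow> (nat \<Rightarrow> real) \<Rightarrow> (nat \<Rightarrow> real) \<Rightarrow> nat \<Rightarrow> real" where
  "cyclic_residual k a b c x i = a i * x (cyclic_pred k i) + b i * x i + c i * x (cyclic_succ k i)"

definition cyclic_window :: "nat \<Rightarrow> (nat \<Rightarrow> real) \<Rightarrow> nat \<Rightarrow> real^2" where
  "cyclic_window k x m = vector [x (m mod k), x (Suc m mod k)]"

text \<open>The map \<open>(x m, x (m + 1)) \<mapsto> (x (m + 1), x (m + 2))\<close> given by the recurrence
  \<open>a * x m + b * x (m + 1) + c * x (m + 2) = 0\<close>.\<close>

definition transfer_matrix :: "real \<Rightarrow> real \<Rightarrow> real \<Rightarrow> real^2^2" where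
  "transfer_matrix a b c = vector [vector [0, 1], vector [- a / c, - b / c]]"

primrec transfer_product ::
    "nat \<Rightarrow> (nat \<Rightarrow> real) \<Rightarrow> (nat \<Rightarrow> real) \<Rightarrow> (nat \<Rightarrow> real) \<Rightarrow> nat \<Rightarrow> real^2^2" where
  "transfer_product k a b c 0 = mat 1"
| "transfer_product k a b c (Suc m) =
     transfer_matrix (a (Suc m mod k)) (b (Suc m mod k)) (c (Suc m mod k)) ** transfer_product k a b c m"

lemma det_transfer_matrix: "det (transfer_matrix a b c) = a / c"
  by (simp add: transfer_matrix_def det_2)

lemma det_transfer_product:
  "det (transfer_product k a b c m) = (\<Prod>j\<in>{1..m}. a (j mod k) / c (j mod k))"
  by (induction m) (simp_all only: transfer_product.simps det_mul det_transfer_matrix,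
      simp_all add: prod.cl_ivl_Suc mult.commute)

lemma prod_mod_cycle:
  fixes g :: "nat \<Rightarrow> 'a::comm_monoid_mult"
  assumes "0 < k"
  shows "(\<Prod>j\<in>{1..k}. g (j mod k)) = (\<Prod>i<k. g i)"
proof -
  have "(\<Prod>j\<in>{1..k}. g (j mod k)) = (\<Prod>j\<in>{1..k}. g (if j = k then 0 else j))"
    by (intro prod.cong) auto
  also have "\<dots> = (\<Prod>i<k. g i)"
    by (rule prod.reindex_bij_witness[where i="\<lambda>i. if i = 0 then k else i" and j="\<lambda>j. if j = k then 0 else j"])
      (use assms in auto)
  finally show ?thesis .
qed

lemma transfer_step:
  assumes "0 < k" "c (Suc m mod k) \<noteq> 0"
  shows "cyclic_window k x (Suc m) - transfer_matrix (a (Suc m mod k)) (b (Suc m mod k)) (c (Suc m mod k)) *v cyclic_window k x m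
    = vector [0, cyclic_residual k a b c x (Suc m mod k) / c (Suc m mod k)]"
proof -
  have "cyclic_pred k (Suc m mod k) = m mod k"
    using assms(1) by (rule cyclic_pred_Suc_mod)
  moreover have "cyclic_succ k (Suc m mod k) = Suc (Suc m) mod k"
    by (simp add: cyclic_succ_def mod_Suc_eq)
  ultimately show ?thesis
    using assms(2)
    by (simp add: vec_eq_iff forall_2 cyclic_window_def transfer_matrix_def cyclic_residual_def
        matrix_vector_mult_def sum_2 field_simps)
qed

lemma transfer_product_approx:
  assumes "0 < k" "\<forall>i<k. c i \<noteq> 0"
  shows "\<exists>K. \<forall>x. norm (cyclic_window k x m - transfer_product k a b c m *v cyclic_window k x 0)
    \<le> K * (\<Sum>i<k. \<bar>cyclic_residual k a b c x i\<bar>)"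
proof (induction m)
  case 0
  show ?case by (auto intro: exI[of _ 0])
next
  case (Suc m)
  define i where "i = Suc m mod k"
  define T where "T = transfer_matrix (a i) (b i) (c i)"
  obtain K where K: "norm (cyclic_window k x m - transfer_product k a b c m *v cyclic_window k x 0)
    \<le> K * (\<Sum>i<k. \<bar>cyclic_residual k a b c x i\<bar>)" for x
    using Suc.IH by blast
  have i: "i < k" "c i \<noteq> 0"
    using assms by (auto simp: i_def)
  show ?case
  proof (intro exI allI)
    fix x
    let ?R = "\<Sum>i<k. \<bar>cyclic_residual k a b c x i\<bar>"
    have step: "norm (cyclic_window k x (Suc m) - T *v cyclic_window k x m) \<le> ?R / \<bar>c i\<bar>"
    proof -
      have "norm (cyclic_window k x (Suc m) - T *v cyclic_window k x m)
          = \<bar>cyclic_residual k a b c x i\<bar> / \<bar>c i\<bar>"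
        using transfer_step[of k c m x a b] assms(1) i(2)
        by (simp add: T_def i_def norm_vec_def L2_set_def sum_2 abs_divide)
      also have "\<dots> \<le> ?R / \<bar>c i\<bar>"
        using i(1) by (intro divide_right_mono member_le_sum) auto
      finally show ?thesis .
    qed
    have propagate: "norm (T *v (cyclic_window k x m - transfer_product k a b c m *v cyclic_window k x 0))
        \<le> onorm ((*v) T) * (K * ?R)"
      using K[of x] onorm[of "(*v) T"] onorm_pos_le[of "(*v) T"]
      by (meson matrix_vector_mul_bounded_linear order_trans mult_left_mono)
    show "norm (cyclic_window k x (Suc m) - transfer_product k a b c (Suc m) *v cyclic_window k x 0)
        \<le> (1 / \<bar>c i\<bar> + onorm ((*v) T) * K) * ?R"
    proof -
      have "cyclic_window k x (Suc m) - transfer_product k a b c (Suc m) *v cyclic_window k x 0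
          = (cyclic_window k x (Suc m) - T *v cyclic_window k x m)
            + T *v (cyclic_window k x m - transfer_product k a b c m *v cyclic_window k x 0)"
        by (simp add: T_def i_def matrix_vector_mul_assoc[symmetric] matrix_vector_mult_diff_distrib)
      also have "norm \<dots> \<le> norm (cyclic_window k x (Suc m) - T *v cyclic_window k x m)
          + norm (T *v (cyclic_window k x m - transfer_product k a b c m *v cyclic_window k x 0))"
        by (rule norm_triangle_ineq)
      also have "\<dots> \<le> ?R / \<bar>c i\<bar> + onorm ((*v) T) * (K * ?R)"
        using step propagate by (rule add_mono)
      also have "\<dots> = (1 / \<bar>c i\<bar> + onorm ((*v) T) * K) * ?R"
        by (simp add: algebra_simps)
      finally show ?thesis .
    qed
  qed
qed

lemma norm_vector2_le: "norm (vector [u, v] :: real^2) \<le> \<bar>u\<bar> + \<bar>v\<bar>"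
  using norm_le_l1_cart[of "vector [u, v] :: real^2"] by (simp add: sum_2)

lemma cyclic_recurrence_sum_bound:
  assumes k: "2 \<le> k" and c: "\<forall>i<k. c i \<noteq> 0"
  obtains C where
    "\<And>x. (\<Sum>j<k. \<bar>x j\<bar>) \<le> C * (\<bar>x 0\<bar> + \<bar>x 1\<bar> + (\<Sum>i<k. \<bar>cyclic_residual k a b c x i\<bar>))"
proof -
  let ?M = "transfer_product k a b c" and ?W = "cyclic_window k"
  define R where "R x = (\<Sum>i<k. \<bar>cyclic_residual k a b c x i\<bar>)" for x
  have "\<exists>K. \<forall>x. norm (?W x m - ?M m *v ?W x 0) \<le> K * R x" for m
    unfolding R_def using k c by (intro transfer_product_approx) auto
  then obtain K where K: "\<And>m x. norm (?W x m - ?M m *v ?W x 0) \<le> K m * R x"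
    by metis
  define C where "C = (\<Sum>j<k. onorm ((*v) (?M j)) + \<bar>K j\<bar>)"
  show thesis
  proof (rule that[of C])
    fix x
    have "0 \<le> R x"
      by (simp add: R_def sum_nonneg)
    have "\<bar>x j\<bar> \<le> (onorm ((*v) (?M j)) + \<bar>K j\<bar>) * (\<bar>x 0\<bar> + \<bar>x 1\<bar> + R x)" if "j < k" for j
    proof -
      have "norm (?M j *v ?W x 0) \<le> onorm ((*v) (?M j)) * (\<bar>x 0\<bar> + \<bar>x 1\<bar>)"
        using onorm[of "(*v) (?M j)" "?W x 0"] norm_vector2_le[of "x 0" "x 1"] onorm_pos_le[of "(*v) (?M j)"] k
        by (simp add: cyclic_window_def) (meson mult_left_mono order_trans)
      moreover have "norm (?W x j - ?M j *v ?W x 0) \<le> \<bar>K j\<bar> * R x"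
        using K[where m=j and x=x] \<open>0 \<le> R x\<close> by (meson abs_ge_self mult_right_mono order_trans)
      moreover have "\<bar>x j\<bar> \<le> norm (?W x j)"
        using component_le_norm_cart[of "?W x j" 1] that by (simp add: cyclic_window_def)
      ultimately have "\<bar>x j\<bar> \<le> onorm ((*v) (?M j)) * (\<bar>x 0\<bar> + \<bar>x 1\<bar>) + \<bar>K j\<bar> * R x"
        using norm_triangle_sub[of "?W x j" "?M j *v ?W x 0"] by linarith
      also have "\<dots> \<le> (onorm ((*v) (?M j)) + \<bar>K j\<bar>) * (\<bar>x 0\<bar> + \<bar>x 1\<bar> + R x)"
        using \<open>0 \<le> R x\<close> onorm_pos_le[of "(*v) (?M j)"] by (simp add: algebra_simps)
      finally show ?thesis .
    qed
    then have "(\<Sum>j<k. \<bar>x j\<bar>) \<le> (\<Sum>j<k. (onorm ((*v) (?M j)) + \<bar>K j\<bar>) * (\<bar>x 0\<bar> + \<bar>x 1\<bar> + R x))"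
      by (intro sum_mono) auto
    then show "(\<Sum>j<k. \<bar>x j\<bar>) \<le> C * (\<bar>x 0\<bar> + \<bar>x 1\<bar> + (\<Sum>i<k. \<bar>cyclic_residual k a b c x i\<bar>))"
      by (simp add: C_def R_def sum_distrib_right)
  qed
qed

text \<open>Going once around the cycle, an approximate solution returns to its initial window, while
  the monodromy matrix has determinant \<open>\<Prod>i. a i / c i \<noteq> 1\<close>; a nonzero row of the monodromy
  minus the identity gives the linear form.\<close>

lemma cyclic_recurrence_functional:
  assumes k: "2 \<le> k" and c: "\<forall>i<k. c i \<noteq> 0" and monodromy: "(\<Prod>i<k. a i / c i) \<noteq> 1"
  obtains q :: "real \<times> real" and C where "q \<noteq> 0"
    "\<And>x. \<bar>q \<bullet> (x 0, x 1)\<bar> \<le> C * (\<Sum>i<k. \<bar>cyclic_residual k a b c x i\<bar>)"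
proof -
  let ?M = "transfer_product k a b c k" and ?W = "cyclic_window k"
  obtain K where K: "\<And>x. norm (?W x k - ?M *v ?W x 0) \<le> K * (\<Sum>i<k. \<bar>cyclic_residual k a b c x i\<bar>)"
    using transfer_product_approx[of k c k a b] k c by auto
  have "det ?M = (\<Prod>i<k. a i / c i)"
    unfolding det_transfer_product using k by (intro prod_mod_cycle) auto
  then have "?M - mat 1 \<noteq> 0"
    using monodromy by auto
  then obtain i0 j0 where ij: "(?M - mat 1) $ i0 $ j0 \<noteq> 0"
    by (metis vec_eq_iff zero_index)
  define q where "q = ((?M - mat 1) $ i0 $ 1, (?M - mat 1) $ i0 $ 2)"
  show thesis
  proof (rule that[of q K])
    show "q \<noteq> 0"
      using ij exhaust_2[of j0] by (auto simp: q_def zero_prod_def)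
    fix x
    have W0: "?W x 0 = vector [x 0, x 1]" and Wk: "?W x k = ?W x 0"
      using k by (simp_all add: cyclic_window_def mod_Suc)
    have "\<bar>q \<bullet> (x 0, x 1)\<bar> = \<bar>((?M - mat 1) *v ?W x 0) $ i0\<bar>"
      by (simp add: W0 q_def matrix_vector_mult_def sum_2)
    also have "\<dots> \<le> norm ((?M - mat 1) *v ?W x 0)"
      by (rule component_le_norm_cart)
    also have "(?M - mat 1) *v ?W x 0 = - (?W x k - ?M *v ?W x 0)"
      by (simp add: Wk matrix_vector_mult_diff_rdistrib)
    also have "norm \<dots> \<le> K * (\<Sum>i<k. \<bar>cyclic_residual k a b c x i\<bar>)"
      unfolding norm_minus_cancel by (rule K)
    finally show "\<bar>q \<bullet> (x 0, x 1)\<bar> \<le> K * (\<Sum>i<k. \<bar>cyclic_residual k a b c x i\<bar>)" .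
  qed
qed

lemma cyclic_recurrence_near_kernel:
  assumes "2 \<le> k" "\<forall>i<k. c i \<noteq> 0" "(\<Prod>i<k. a i / c i) \<noteq> 1"
  obtains q :: "real \<times> real" where "q \<noteq> 0"
    "\<And>\<epsilon>. 0 < \<epsilon> \<Longrightarrow> \<exists>\<eta>>0. \<forall>x. (\<forall>i<k. \<bar>cyclic_residual k a b c x i\<bar> \<le> \<eta> * (\<Sum>j<k. \<bar>x j\<bar>))
        \<longrightarrow> \<bar>q \<bullet> (x 0, x 1)\<bar> \<le> \<epsilon> * (\<bar>x 0\<bar> + \<bar>x 1\<bar>)"
proof -
  obtain q C1 where "q \<noteq> 0"
    and functional: "\<And>x. \<bar>q \<bullet> (x 0, x 1)\<bar> \<le> C1 * (\<Sum>i<k. \<bar>cyclic_residual k a b c x i\<bar>)"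
    using cyclic_recurrence_functional[OF assms] by blast
  obtain C2 where sum_bound:
    "\<And>x. (\<Sum>j<k. \<bar>x j\<bar>) \<le> C2 * (\<bar>x 0\<bar> + \<bar>x 1\<bar> + (\<Sum>i<k. \<bar>cyclic_residual k a b c x i\<bar>))"
    using cyclic_recurrence_sum_bound[OF assms(1,2)] by blast
  define C where "C = \<bar>C1\<bar> + \<bar>C2\<bar> + 1"
  have "0 < C" "C1 \<le> C" "C2 \<le> C"
    by (simp_all add: C_def)
  show thesis
  proof (rule that[OF \<open>q \<noteq> 0\<close>])
    fix \<epsilon> :: real assume "0 < \<epsilon>"
    define \<eta> where "\<eta> = min (1 / (2 * k * C)) (\<epsilon> / (2 * k * C\<^sup>2))"
    have "0 < k"
      using assms(1) by simp
    then have "0 < \<eta>" and \<kappa>: "k * \<eta> * C \<le> 1 / 2" and \<epsilon>: "2 * C * (k * \<eta> * C) \<le> \<epsilon>"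
      using \<open>0 < C\<close> \<open>0 < \<epsilon>\<close> by (auto simp: \<eta>_def min_def field_simps power2_eq_square)
    moreover have "\<bar>q \<bullet> (x 0, x 1)\<bar> \<le> \<epsilon> * (\<bar>x 0\<bar> + \<bar>x 1\<bar>)"
      if small: "\<forall>i<k. \<bar>cyclic_residual k a b c x i\<bar> \<le> \<eta> * (\<Sum>j<k. \<bar>x j\<bar>)" for x
    proof -
      define R where "R = (\<Sum>i<k. \<bar>cyclic_residual k a b c x i\<bar>)"
      define n where "n = \<bar>x 0\<bar> + \<bar>x 1\<bar>"
      have "0 \<le> R" "0 \<le> n" "0 \<le> k * \<eta>"
        using \<open>0 < \<eta>\<close> by (simp_all add: R_def n_def sum_nonneg)
      have "R \<le> (\<Sum>i<k. \<eta> * (\<Sum>j<k. \<bar>x j\<bar>))"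
        unfolding R_def using small by (intro sum_mono) simp
      also have "\<dots> = k * \<eta> * (\<Sum>j<k. \<bar>x j\<bar>)"
        by simp
      also have "\<dots> \<le> k * \<eta> * (C * (n + R))"
        using sum_bound[of x] mult_right_mono[OF \<open>C2 \<le> C\<close>, of "n + R"] \<open>0 \<le> R\<close> \<open>0 \<le> n\<close> \<open>0 \<le> k * \<eta>\<close>
        unfolding R_def n_def by (intro mult_left_mono) auto
      finally have R_le: "R \<le> (k * \<eta> * C) * (n + R)"
        by (simp add: mult.assoc)
      also have "\<dots> \<le> 1 / 2 * (n + R)"
        using \<kappa> \<open>0 \<le> R\<close> \<open>0 \<le> n\<close> by (intro mult_right_mono) auto
      finally have "R \<le> n"
        by simp
      then have "R \<le> (k * \<eta> * C) * (2 * n)"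
        using R_le \<open>0 \<le> k * \<eta>\<close> \<open>0 < C\<close> mult_left_mono[of "n + R" "2 * n" "k * \<eta> * C"] by simp
      have "\<bar>q \<bullet> (x 0, x 1)\<bar> \<le> C * R"
        using functional[of x] mult_right_mono[OF \<open>C1 \<le> C\<close> \<open>0 \<le> R\<close>] unfolding R_def by linarith
      also have "\<dots> \<le> C * ((k * \<eta> * C) * (2 * n))"
        using \<open>R \<le> (k * \<eta> * C) * (2 * n)\<close> \<open>0 < C\<close> by simp
      also have "\<dots> = (2 * C * (k * \<eta> * C)) * n"
        by (simp add: algebra_simps)
      also have "\<dots> \<le> \<epsilon> * n"
        using \<epsilon> \<open>0 \<le> n\<close> by (rule mult_right_mono)
      finally show ?thesis
        by (simp add: n_def)
    qed
    ultimately show "\<exists>\<eta>>0. \<forall>x. (\<forall>i<k. \<bar>cyclic_residual k a b c x i\<bar> \<le> \<eta> * (\<Sum>j<k. \<bar>x j\<bar>))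
        \<longrightarrow> \<bar>q \<bullet> (x 0, x 1)\<bar> \<le> \<epsilon> * (\<bar>x 0\<bar> + \<bar>x 1\<bar>)"
      by blast
  qed
qed

section \<open>Reflections in the plane\<close>

lemma inner_vec2: "(x::real^2) \<bullet> y = x$1 * y$1 + x$2 * y$2"
  by (simp add: inner_vec_def sum_2)

lemma reflect_dir_reflect_dir:
  assumes "v \<noteq> 0"
  shows "reflect_dir v (reflect_dir v w) = w"
proof -
  have "reflect_dir v w \<bullet> v = w \<bullet> v"
    using assms by (simp add: reflect_dir_def inner_diff_left)
  then show ?thesis
    by (simp add: reflect_dir_def)
qed

lemma reflect_dir_scaleR: "reflect_dir v (c *\<^sub>R w) = c *\<^sub>R reflect_dir v w"
  by (simp add: reflect_dir_def scaleR_diff_right)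

lemma det2_scaleR_left: "det2 (c *\<^sub>R a) b = c * det2 a b"
  and det2_scaleR_right: "det2 a (c *\<^sub>R b) = c * det2 a b"
  and det2_swap: "det2 b a = - det2 a b"
  by (simp_all add: det2_def algebra_simps)

lemma det2_reflect_dir_swap:
  assumes "v \<noteq> 0"
  shows "det2 (reflect_dir v a) b = - det2 a (reflect_dir v b)"
proof -
  have vv: "v \<bullet> v \<noteq> 0"
    using assms by simp
  have "(a \<bullet> v) * det2 v b + (b \<bullet> v) * det2 a v = (v \<bullet> v) * det2 a b"
    unfolding inner_vec2 det2_def by algebra
  then have "(a \<bullet> v) / (v \<bullet> v) * det2 v b + (b \<bullet> v) / (v \<bullet> v) * det2 a v = det2 a b"
    using vv by (simp add: divide_simps algebra_simps)
  moreover have "det2 (reflect_dir v a) b = 2 * ((a \<bullet> v) / (v \<bullet> v) * det2 v b) - det2 a b"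
    and "det2 a (reflect_dir v b) = 2 * ((b \<bullet> v) / (v \<bullet> v) * det2 a v) - det2 a b"
    by (simp_all add: reflect_dir_def det2_def algebra_simps)
  ultimately show ?thesis
    by linarith
qed

lemma det2_eq_0_imp_parallel:
  assumes "det2 u y = 0" "y \<noteq> 0"
  obtains \<mu> where "u = \<mu> *\<^sub>R y"
proof (cases "y$1 = 0")
  case True
  then have "y$2 \<noteq> 0"
    using assms(2) by (auto simp: vec_eq_iff forall_2)
  with True assms(1) show thesis
    by (intro that[of "u$2 / y$2"]) (auto simp: det2_def vec_eq_iff forall_2)
next
  case False
  with assms(1) show thesis
    by (intro that[of "u$1 / y$1"]) (auto simp: det2_def vec_eq_iff forall_2 field_simps)
qed

lemma det2_reflect_dir_products:
  assumes v: "v \<noteq> 0" and "x \<noteq> 0" "y \<noteq> 0" and refl: "det2 (reflect_dir v x) y = 0"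
  shows "det2 (reflect_dir v p) y * det2 (reflect_dir v x) n = det2 p x * det2 n y"
proof -
  obtain \<mu> where \<mu>: "reflect_dir v x = \<mu> *\<^sub>R y"
    using det2_eq_0_imp_parallel[OF refl \<open>y \<noteq> 0\<close>] .
  have x: "x = \<mu> *\<^sub>R reflect_dir v y"
    using reflect_dir_reflect_dir[OF v, of x] by (simp add: \<mu> reflect_dir_scaleR)
  with \<open>x \<noteq> 0\<close> have "\<mu> \<noteq> 0" by auto
  have "det2 (reflect_dir v p) y = - det2 p x / \<mu>"
    using \<open>\<mu> \<noteq> 0\<close> by (simp add: det2_reflect_dir_swap[OF v] x det2_scaleR_right)
  moreover have "det2 (reflect_dir v x) n = - \<mu> * det2 n y"
    by (simp add: \<mu> det2_scaleR_left det2_swap[of n y])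
  ultimately show ?thesis
    using \<open>\<mu> \<noteq> 0\<close> by simp
qed

lemma prod_neg_iff_odd_card:
  fixes x :: "'a \<Rightarrow> 'b::linordered_idom"
  assumes "finite J" "\<forall>j\<in>J. x j \<noteq> 0"
  shows "prod x J < 0 \<longleftrightarrow> odd (card {j\<in>J. x j < 0})"
  using assms
proof (induction J rule: finite_induct)
  case (insert a J)
  have "prod x J \<noteq> 0" "x a \<noteq> 0"
    using insert by auto
  then have "prod x J < 0 \<or> 0 < prod x J"
    by (metis neq_iff)
  have "{j\<in>insert a J. x j < 0} = (if x a < 0 then insert a {j\<in>J. x j < 0} else {j\<in>J. x j < 0})"
    by auto
  then have "card {j\<in>insert a J. x j < 0} = (if x a < 0 then Suc else id) (card {j\<in>J. x j < 0})"
    using insert(1,2) by simp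
  then show ?case
    using insert \<open>prod x J < 0 \<or> 0 < prod x J\<close> \<open>x a \<noteq> 0\<close> by (auto simp: mult_less_0_iff)
qed simp

lemma prod_divide_neg_if_prod_mult_neg:
  fixes a c :: "'a \<Rightarrow> real"
  assumes "(\<Prod>i\<in>I. a i * c i) < 0"
  shows "\<forall>i\<in>I. c i \<noteq> 0" and "(\<Prod>i\<in>I. a i / c i) < 0"
proof -
  have "finite I"
    using assms by (metis prod.infinite zero_less_one not_less_iff_gr_or_eq)
  show c: "\<forall>i\<in>I. c i \<noteq> 0"
  proof (intro ballI notI)
    fix i assume "i \<in> I" "c i = 0"
    then have "(\<Prod>i\<in>I. a i * c i) = 0"
      using \<open>finite I\<close> by (intro prod_zero) auto
    with assms show False
      by simp
  qed
  have "(\<Prod>i\<in>I. a i / c i) = (\<Prod>i\<in>I. (a i * c i) / (c i * c i))"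
    using c by (intro prod.cong) auto
  also have "\<dots> = (\<Prod>i\<in>I. a i * c i) / (\<Prod>i\<in>I. c i * c i)"
    by (rule prod_dividef)
  finally have "(\<Prod>i\<in>I. a i / c i) = (\<Prod>i\<in>I. a i * c i) / (\<Prod>i\<in>I. c i * c i)" .
  moreover have "0 < (\<Prod>i\<in>I. c i * c i)"
    using c by (intro prod_pos) (auto simp: zero_less_mult_iff linorder_neq_iff)
  ultimately show "(\<Prod>i\<in>I. a i / c i) < 0"
    using assms by (simp add: divide_neg_pos)
qed

lemma periodic_orbit_refl_law:
  assumes "periodic_orbit k \<gamma> skew t" "j < k"
  shows "refl_law (skew j) (vector_derivative (\<gamma> j) (at (t j))) (\<gamma> j (t j))
      (\<gamma> (cyclic_pred k j) (t (cyclic_pred k j))) (\<gamma> (cyclic_succ k j) (t (cyclic_succ k j)))"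
  using assms by (simp add: periodic_orbit_def vertex_ok_def cyclic_pred_def cyclic_succ_def)

lemma refl_law_tangent_nonzero: "refl_law skew v P Qm Qp \<Longrightarrow> v \<noteq> 0"
  by (auto simp: refl_law_def det2_def)

lemma refl_law_sides_sign:
  "refl_law skew v P Qm Qp \<Longrightarrow> det2 v (Qm - P) * det2 v (Qp - P) < 0 \<longleftrightarrow> skew"
  and refl_law_sides_nonzero:
  "refl_law skew v P Qm Qp \<Longrightarrow> det2 v (Qm - P) * det2 v (Qp - P) \<noteq> 0"
  by (cases skew; auto simp: refl_law_def)+

text \<open>The factors are the coefficients \<open>a j\<close>, \<open>c j\<close> of the linearized reflection law (see
  \<open>periodic_orbit_linearization\<close>). Each \<open>a j * c j\<close> is a product of side determinants at the two
  neighbours of vertex \<open>j\<close>; regrouping the product by vertices leaves at each vertex the product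
  of its two side determinants, whose sign is fixed by the reflection law.\<close>

lemma periodic_orbit_coefficient_product:
  fixes \<gamma> :: "nat \<Rightarrow> real \<Rightarrow> real^2" and t :: "nat \<Rightarrow> real"
  defines "P j \<equiv> \<gamma> j (t j)" and "V j \<equiv> vector_derivative (\<gamma> j) (at (t j))"
  assumes orbit: "periodic_orbit k \<gamma> skew t" and "0 < k"
  shows "(\<Prod>j<k. det2 (reflect_dir (V j) (V (cyclic_pred k j))) (P (cyclic_succ k j) - P j)
                * det2 (reflect_dir (V j) (P (cyclic_pred k j) - P j)) (V (cyclic_succ k j))) < 0
    \<longleftrightarrow> odd (card {j. j < k \<and> skew j})"
proof -
  let ?pred = "cyclic_pred k" and ?succ = "cyclic_succ k"
  have law: "refl_law (skew j) (V j) (P j) (P (?pred j)) (P (?succ j))" if "j < k" for j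
    using periodic_orbit_refl_law[OF orbit that] by (simp add: P_def V_def)
  define \<sigma> where "\<sigma> l m = det2 (V l) (P l - P m)" for l m
  define w where "w l = det2 (V l) (P (?pred l) - P l) * det2 (V l) (P (?succ l) - P l)" for l
  have "det2 (reflect_dir (V j) (V (?pred j))) (P (?succ j) - P j)
        * det2 (reflect_dir (V j) (P (?pred j) - P j)) (V (?succ j)) = \<sigma> (?pred j) j * \<sigma> (?succ j) j"
    if "j < k" for j
    unfolding \<sigma>_def using law[OF that]
    by (intro det2_reflect_dir_products[OF refl_law_tangent_nonzero]) (auto simp: refl_law_def)
  then have "(\<Prod>j<k. det2 (reflect_dir (V j) (V (?pred j))) (P (?succ j) - P j)
        * det2 (reflect_dir (V j) (P (?pred j) - P j)) (V (?succ j)))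
      = (\<Prod>j<k. \<sigma> (?pred j) j) * (\<Prod>j<k. \<sigma> (?succ j) j)"
    by (simp add: prod.distrib)
  also have "\<dots> = (\<Prod>l<k. \<sigma> l (?succ l)) * (\<Prod>l<k. \<sigma> l (?pred l))"
  proof -
    have "(\<Prod>j<k. \<sigma> (?pred j) j) = (\<Prod>j<k. \<sigma> (?pred j) (?succ (?pred j)))"
      and "(\<Prod>j<k. \<sigma> (?succ j) j) = (\<Prod>j<k. \<sigma> (?succ j) (?pred (?succ j)))"
      by (simp_all add: cyclic_pred_succ cyclic_succ_pred)
    then show ?thesis
      by (simp only: prod_cyclic_pred[of "\<lambda>l. \<sigma> l (?succ l)"] prod_cyclic_succ[of "\<lambda>l. \<sigma> l (?pred l)"])
  qed
  also have "\<dots> = (\<Prod>l<k. w l)"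
    by (simp add: \<sigma>_def w_def prod.distrib[symmetric] det2_def algebra_simps)
  finally have "?thesis \<longleftrightarrow> (\<Prod>l<k. w l) < 0 \<longleftrightarrow> odd (card {j. j < k \<and> skew j})"
    by simp
  moreover have "\<forall>l\<in>{..<k}. w l \<noteq> 0"
    using refl_law_sides_nonzero[OF law] by (simp add: w_def)
  moreover have "{l\<in>{..<k}. w l < 0} = {j. j < k \<and> skew j}"
    using refl_law_sides_sign[OF law] by (auto simp: w_def)
  ultimately show ?thesis
    using prod_neg_iff_odd_card[of "{..<k}" w] by simp
qed

section \<open>First-order expansion of the reflection law\<close>

lemma finite_common_radius:
  fixes P :: "'a \<Rightarrow> real \<Rightarrow> bool"
  assumes "finite I" and radius: "\<And>i. i \<in> I \<Longrightarrow> \<exists>\<rho>>0. P i \<rho>"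
    and mono: "\<And>i \<rho> \<rho>'. i \<in> I \<Longrightarrow> P i \<rho> \<Longrightarrow> 0 < \<rho>' \<Longrightarrow> \<rho>' \<le> \<rho> \<Longrightarrow> P i \<rho>'"
  obtains \<rho> where "0 < \<rho>" "\<And>i. i \<in> I \<Longrightarrow> P i \<rho>"
proof -
  have "eventually (P i) (at_right 0)" if i: "i \<in> I" for i
  proof -
    obtain \<rho> where "0 < \<rho>" "P i \<rho>"
      using radius[OF i] by blast
    then show ?thesis
      unfolding eventually_at_right_field using mono[OF i] by (meson less_imp_le)
  qed
  then have "eventually (\<lambda>\<rho>. \<forall>i\<in>I. P i \<rho>) (at_right 0)"
    by (simp add: eventually_ball_finite_distrib \<open>finite I\<close>)
  then obtain e :: real where "0 < e" and e: "\<And>\<rho>. 0 < \<rho> \<Longrightarrow> \<rho> < e \<Longrightarrow> \<forall>i\<in>I. P i \<rho>"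
    unfolding eventually_at_right_field by blast
  show thesis
    using that[of "e / 2"] e[of "e / 2"] \<open>0 < e\<close> by simp
qed

lemma has_derivative_along_path:
  assumes G: "(G has_derivative D) (at (g t0))"
    and g: "(g has_derivative (\<lambda>h. h *\<^sub>R e)) (at t0)"
    and Gg: "((\<lambda>t. G (g t)) has_derivative (\<lambda>h. h * a)) (at t0)"
  shows "D e = a"
proof -
  have "((\<lambda>t. G (g t)) has_derivative (\<lambda>h. D (h *\<^sub>R e))) (at t0)"
    using diff_chain_at[OF g G] by (simp add: comp_def)
  with Gg have "(\<lambda>h. h * a) = (\<lambda>h. D (h *\<^sub>R e))"
    by (rule has_derivative_unique)
  from fun_cong[OF this, of 1] show ?thesis
    by simp
qed

lemma has_derivative_expansion3:
  fixes G :: "real \<times> real \<times> real \<Rightarrow> real"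
  assumes G: "(G has_derivative D) (at (s0, u0, w0))" and "0 < \<eta>"
  obtains \<rho> where "0 < \<rho>"
    "\<And>s u w. \<bar>s - s0\<bar> < \<rho> \<Longrightarrow> \<bar>u - u0\<bar> < \<rho> \<Longrightarrow> \<bar>w - w0\<bar> < \<rho> \<Longrightarrow>
      \<bar>G (s, u, w) - G (s0, u0, w0) - (D (1, 0, 0) * (s - s0) + D (0, 1, 0) * (u - u0) + D (0, 0, 1) * (w - w0))\<bar>
        \<le> \<eta> * (\<bar>s - s0\<bar> + \<bar>u - u0\<bar> + \<bar>w - w0\<bar>)"
proof -
  obtain d where "0 < d" and d: "\<And>y. norm (y - (s0, u0, w0)) < d \<Longrightarrow>
      norm (G y - G (s0, u0, w0) - D (y - (s0, u0, w0))) \<le> \<eta> * norm (y - (s0, u0, w0))"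
    using G[unfolded has_derivative_at_alt] \<open>0 < \<eta>\<close> by blast
  have lin: "linear D"
    using G by (rule has_derivative_linear)
  have D3: "D (x, y, z) = D (1, 0, 0) * x + D (0, 1, 0) * y + D (0, 0, 1) * z" for x y z
  proof -
    have "(x, y, z) = x *\<^sub>R (1, 0, 0) + y *\<^sub>R (0, 1, 0) + z *\<^sub>R ((0, 0, 1) :: real \<times> real \<times> real)"
      by simp
    then show ?thesis
      by (simp only: linear_add[OF lin] linear_scale[OF lin]) (simp add: mult.commute)
  qed
  have norm3: "norm (x, y, z) \<le> \<bar>x\<bar> + \<bar>y\<bar> + \<bar>z\<bar>" for x y z :: real
    using norm_Pair_le[of x "(y, z)"] norm_Pair_le[of y z] by simp
  show thesis
  proof (rule that[of "d / 3"])
    fix s u w assume "\<bar>s - s0\<bar> < d / 3" "\<bar>u - u0\<bar> < d / 3" "\<bar>w - w0\<bar> < d / 3"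
    then have "norm ((s, u, w) - (s0, u0, w0)) < d"
      using norm3[of "s - s0" "u - u0" "w - w0"] by simp
    from d[OF this] have "\<bar>G (s, u, w) - G (s0, u0, w0) - D (s - s0, u - u0, w - w0)\<bar>
        \<le> \<eta> * norm (s - s0, u - u0, w - w0)"
      by (simp only: diff_Pair real_norm_def)
    also have "\<dots> \<le> \<eta> * (\<bar>s - s0\<bar> + \<bar>u - u0\<bar> + \<bar>w - w0\<bar>)"
      using \<open>0 < \<eta>\<close> by (intro mult_left_mono norm3) simp
    finally show "\<bar>G (s, u, w) - G (s0, u0, w0) - (D (1, 0, 0) * (s - s0) + D (0, 1, 0) * (u - u0)
        + D (0, 0, 1) * (w - w0))\<bar> \<le> \<eta> * (\<bar>s - s0\<bar> + \<bar>u - u0\<bar> + \<bar>w - w0\<bar>)"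
      by (simp only: D3[of "s - s0" "u - u0" "w - w0"])
  qed (use \<open>0 < d\<close> in simp)
qed

lemma differentiable_vec_nth [derivative_intros]:
  "f differentiable F \<Longrightarrow> (\<lambda>x. f x $ i) differentiable F"
  unfolding differentiable_def using bounded_linear.has_derivative[OF bounded_linear_vec_nth] by blast

lemma differentiable_det2 [derivative_intros]:
  "f differentiable (at x within S) \<Longrightarrow> g differentiable (at x within S) \<Longrightarrow>
    (\<lambda>x. det2 (f x) (g x)) differentiable (at x within S)"
  unfolding det2_def by (intro differentiable_diff differentiable_mult differentiable_vec_nth)

lemma differentiable_reflect_dir [derivative_intros]:
  assumes "v differentiable (at x)" "w differentiable (at x)" "v x \<noteq> 0"
  shows "(\<lambda>x. reflect_dir (v x) (w x)) differentiable (at x)"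
  unfolding reflect_dir_def using assms
  by (intro differentiable_diff differentiable_scaleR differentiable_divide differentiable_mult
      differentiable_inner differentiable_const) auto

lemma bounded_linear_det2_reflect_dir: "bounded_linear (\<lambda>w. det2 (reflect_dir v w) y)"
  and bounded_linear_det2_right: "bounded_linear (\<lambda>w. det2 x w)"
  by (auto intro!: linear_conv_bounded_linear[THEN iffD1] linearI
      simp: det2_def reflect_dir_def inner_add_left algebra_simps add_divide_distrib)

lemma det2_reflect_dir_expansion:
  fixes p q V r :: "real \<Rightarrow> real^2"
  defines "F s u w \<equiv> det2 (reflect_dir (V u) (p s - q u)) (r w - q u)"
  assumes p: "(p has_vector_derivative P') (at s0)" and q: "q differentiable (at u0)"
    and V: "V differentiable (at u0)" "V u0 \<noteq> 0" and r: "(r has_vector_derivative R') (at w0)"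
  shows "\<exists>b. \<forall>\<eta>>0. \<exists>\<rho>>0. \<forall>s u w. \<bar>s - s0\<bar> < \<rho> \<longrightarrow> \<bar>u - u0\<bar> < \<rho> \<longrightarrow> \<bar>w - w0\<bar> < \<rho> \<longrightarrow>
      \<bar>F s u w - F s0 u0 w0 - (det2 (reflect_dir (V u0) P') (r w0 - q u0) * (s - s0) + b * (u - u0)
        + det2 (reflect_dir (V u0) (p s0 - q u0)) R' * (w - w0))\<bar>
      \<le> \<eta> * (\<bar>s - s0\<bar> + \<bar>u - u0\<bar> + \<bar>w - w0\<bar>)"
proof -
  define G where "G x = F (fst x) (fst (snd x)) (snd (snd x))" for x :: "real \<times> real \<times> real"
  let ?x0 = "(s0, u0, w0)"
  have coord: "(\<lambda>x. f (c x)) differentiable (at ?x0)"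
    if "f differentiable (at (c ?x0))" "bounded_linear c" for f :: "real \<Rightarrow> real^2" and c
    using differentiable_chain_at[OF bounded_linear_imp_differentiable[OF that(2)] that(1)]
    by (simp add: comp_def)
  have "G differentiable (at ?x0)"
    unfolding G_def F_def using V differentiableI_vector[OF p] differentiableI_vector[OF r] q
    by (intro derivative_intros coord bounded_linear_fst bounded_linear_snd
        bounded_linear_compose[OF bounded_linear_fst bounded_linear_snd]
        bounded_linear_compose[OF bounded_linear_snd bounded_linear_snd]) auto
  then obtain D where D: "(G has_derivative D) (at ?x0)"
    by (auto simp: differentiable_def)
  have Gs: "((\<lambda>s. G (s, u0, w0)) has_derivative (\<lambda>h. h * det2 (reflect_dir (V u0) P') (r w0 - q u0))) (at s0)"
    using bounded_linear.has_derivative[OF bounded_linear_det2_reflect_dir,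
        OF has_derivative_diff[OF p[unfolded has_vector_derivative_def] has_derivative_const]]
    by (simp add: G_def F_def reflect_dir_scaleR det2_scaleR_left)
  have Ds: "D (1, 0, 0) = det2 (reflect_dir (V u0) P') (r w0 - q u0)"
    by (intro has_derivative_along_path[where g="\<lambda>s. (s, u0, w0)" and e="(1, 0, 0)", OF D _ Gs])
      (auto intro!: derivative_eq_intros simp: zero_prod_def)
  have Gw: "((\<lambda>w. G (s0, u0, w)) has_derivative (\<lambda>h. h * det2 (reflect_dir (V u0) (p s0 - q u0)) R')) (at w0)"
    using bounded_linear.has_derivative[OF bounded_linear_det2_right,
        OF has_derivative_diff[OF r[unfolded has_vector_derivative_def] has_derivative_const]]
    by (simp add: G_def F_def det2_scaleR_right)
  have Dw: "D (0, 0, 1) = det2 (reflect_dir (V u0) (p s0 - q u0)) R'"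
    by (intro has_derivative_along_path[where g="\<lambda>w. (s0, u0, w)" and e="(0, 0, 1)", OF D _ Gw])
      (auto intro!: derivative_eq_intros simp: zero_prod_def)
  show ?thesis
  proof (rule exI[of _ "D (0, 1, 0)"], intro allI impI)
    fix \<eta> :: real assume "0 < \<eta>"
    with has_derivative_expansion3[OF D] obtain \<rho> where "0 < \<rho>" and \<rho>:
      "\<And>s u w. \<bar>s - s0\<bar> < \<rho> \<Longrightarrow> \<bar>u - u0\<bar> < \<rho> \<Longrightarrow> \<bar>w - w0\<bar> < \<rho> \<Longrightarrow>
        \<bar>G (s, u, w) - G ?x0 - (D (1, 0, 0) * (s - s0) + D (0, 1, 0) * (u - u0) + D (0, 0, 1) * (w - w0))\<bar>
          \<le> \<eta> * (\<bar>s - s0\<bar> + \<bar>u - u0\<bar> + \<bar>w - w0\<bar>)"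
      by blast
    then show "\<exists>\<rho>>0. \<forall>s u w. \<bar>s - s0\<bar> < \<rho> \<longrightarrow> \<bar>u - u0\<bar> < \<rho> \<longrightarrow> \<bar>w - w0\<bar> < \<rho> \<longrightarrow>
      \<bar>F s u w - F s0 u0 w0 - (det2 (reflect_dir (V u0) P') (r w0 - q u0) * (s - s0) + D (0, 1, 0) * (u - u0)
        + det2 (reflect_dir (V u0) (p s0 - q u0)) R' * (w - w0))\<bar>
      \<le> \<eta> * (\<bar>s - s0\<bar> + \<bar>u - u0\<bar> + \<bar>w - w0\<bar>)"
      by (auto simp: G_def Ds Dw)
  qed
qed

section \<open>Periodic orbits near a periodic orbit\<close>

lemma periodic_orbit_three_le:
  assumes orbit: "periodic_orbit k \<gamma> skew t" and odd: "odd (card {j. j < k \<and> skew j})"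
  shows "3 \<le> k"
proof (rule ccontr)
  assume "\<not> 3 \<le> k"
  moreover have "k \<noteq> 0"
    using odd by (rule contrapos_nn) simp
  ultimately have "k = 1 \<or> k = 2"
    by linarith
  then have "cyclic_pred k j = cyclic_succ k j" if "j < k" for j
    using that by (auto simp: cyclic_pred_def cyclic_succ_def less_2_cases_iff)
  then have "\<not> skew j" if "j < k" for j
    using periodic_orbit_refl_law[OF orbit that] that by (auto simp: refl_law_def mult_less_0_iff)
  then have "{j. j < k \<and> skew j} = {}"
    by blast
  with odd show False
    by simp
qed

text \<open>\<open>a j\<close> and \<open>c j\<close> are the partial derivatives of the reflection defect at vertex \<open>j\<close> with
  respect to the parameters of its two neighbours.\<close>

lemma periodic_orbit_linearization:
  fixes k :: nat and \<gamma> :: "nat \<Rightarrow> real \<Rightarrow> real^2" and t :: "nat \<Rightarrow> real"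
  defines "P j \<equiv> \<gamma> j (t j)" and "V j \<equiv> vector_derivative (\<gamma> j) (at (t j))"
  defines "a j \<equiv> det2 (reflect_dir (V j) (V (cyclic_pred k j))) (P (cyclic_succ k j) - P j)"
    and "c j \<equiv> det2 (reflect_dir (V j) (P (cyclic_pred k j) - P j)) (V (cyclic_succ k j))"
  assumes "0 < k" and orbit: "periodic_orbit k \<gamma> skew t"
    and tangent: "\<And>j. j < k \<Longrightarrow> (\<gamma> j has_vector_derivative V j) (at (t j))"
    and curvature: "\<And>j. j < k \<Longrightarrow> (\<lambda>s. vector_derivative (\<gamma> j) (at s)) differentiable (at (t j))"
  shows "\<exists>b. \<forall>\<eta>>0. \<exists>\<rho>>0. \<forall>t'. periodic_orbit k \<gamma> skew t' \<longrightarrow> (\<forall>j<k. \<bar>t' j - t j\<bar> < \<rho>) \<longrightarrow>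
      (\<forall>i<k. \<bar>cyclic_residual k a b c (\<lambda>j. t' j - t j) i\<bar> \<le> \<eta> * (\<Sum>j<k. \<bar>t' j - t j\<bar>))"
proof -
  let ?pred = "cyclic_pred k" and ?succ = "cyclic_succ k"
  define F where "F j s u w = det2 (reflect_dir (vector_derivative (\<gamma> j) (at u)) (\<gamma> (?pred j) s - \<gamma> j u))
      (\<gamma> (?succ j) w - \<gamma> j u)" for j s u w
  define expansion where "expansion j \<beta> \<eta> \<rho> \<longleftrightarrow> (\<forall>s u w. \<bar>s - t (?pred j)\<bar> < \<rho> \<longrightarrow> \<bar>u - t j\<bar> < \<rho> \<longrightarrow>
      \<bar>w - t (?succ j)\<bar> < \<rho> \<longrightarrow> \<bar>F j s u w - F j (t (?pred j)) (t j) (t (?succ j))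
        - (a j * (s - t (?pred j)) + \<beta> * (u - t j) + c j * (w - t (?succ j)))\<bar>
      \<le> \<eta> * (\<bar>s - t (?pred j)\<bar> + \<bar>u - t j\<bar> + \<bar>w - t (?succ j)\<bar>))" for j \<beta> \<eta> \<rho>
  have "\<exists>\<beta>. \<forall>\<eta>>0. \<exists>\<rho>>0. expansion j \<beta> \<eta> \<rho>" if j: "j < k" for j
  proof -
    have Vj: "V j \<noteq> 0"
      using refl_law_tangent_nonzero[OF periodic_orbit_refl_law[OF orbit j]] by (simp add: V_def)
    show ?thesis
      unfolding expansion_def F_def a_def c_def P_def V_def
      by (rule det2_reflect_dir_expansion[OF tangent[OF cyclic_pred_less[OF \<open>0 < k\<close>, where j=j], unfolded V_def]
          differentiableI_vector[OF tangent[OF j]] curvature[OF j] Vj[unfolded V_def]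
          tangent[OF cyclic_succ_less[OF \<open>0 < k\<close>, where j=j], unfolded V_def]])
  qed
  then obtain b where b: "\<And>j. j \<in> {..<k} \<Longrightarrow> \<forall>\<eta>>0. \<exists>\<rho>>0. expansion j (b j) \<eta> \<rho>"
    using bchoice[of "{..<k}" "\<lambda>j \<beta>. \<forall>\<eta>>0. \<exists>\<rho>>0. expansion j \<beta> \<eta> \<rho>"] by blast
  have expansion_mono: "expansion j \<beta> \<eta> \<rho>'" if "expansion j \<beta> \<eta> \<rho>" "\<rho>' \<le> \<rho>" for j \<beta> \<eta> \<rho> \<rho>'
    using that unfolding expansion_def by (meson less_le_trans)
  have F_orbit: "F j (t' (?pred j)) (t' j) (t' (?succ j)) = 0" if "periodic_orbit k \<gamma> skew t'" "j < k" for t' j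
    using periodic_orbit_refl_law[OF that] by (simp add: F_def refl_law_def)
  show ?thesis
  proof (rule exI[of _ b], intro allI impI)
    fix \<eta> :: real assume "0 < \<eta>"
    obtain \<rho> where "0 < \<rho>" and \<rho>: "\<And>j. j \<in> {..<k} \<Longrightarrow> expansion j (b j) (\<eta> / 3) \<rho>"
    proof (rule finite_common_radius[of "{..<k}" "\<lambda>j. expansion j (b j) (\<eta> / 3)"])
      show "\<exists>\<rho>>0. expansion j (b j) (\<eta> / 3) \<rho>" if "j \<in> {..<k}" for j
        using b[OF that] \<open>0 < \<eta>\<close> by simp
    qed (auto intro: expansion_mono)
    show "\<exists>\<rho>>0. \<forall>t'. periodic_orbit k \<gamma> skew t' \<longrightarrow> (\<forall>j<k. \<bar>t' j - t j\<bar> < \<rho>) \<longrightarrow>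
      (\<forall>i<k. \<bar>cyclic_residual k a b c (\<lambda>j. t' j - t j) i\<bar> \<le> \<eta> * (\<Sum>j<k. \<bar>t' j - t j\<bar>))"
    proof (intro exI[of _ \<rho>] conjI allI impI \<open>0 < \<rho>\<close>)
      fix t' i assume orbit': "periodic_orbit k \<gamma> skew t'" and near: "\<forall>j<k. \<bar>t' j - t j\<bar> < \<rho>"
        and "i < k"
      let ?S = "\<bar>t' (?pred i) - t (?pred i)\<bar> + \<bar>t' i - t i\<bar> + \<bar>t' (?succ i) - t (?succ i)\<bar>"
      have pred: "?pred i < k" and succ: "?succ i < k"
        using \<open>0 < k\<close> by (simp_all add: cyclic_pred_less cyclic_succ_less)
      have "\<bar>F i (t' (?pred i)) (t' i) (t' (?succ i)) - F i (t (?pred i)) (t i) (t (?succ i))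
          - (a i * (t' (?pred i) - t (?pred i)) + b i * (t' i - t i) + c i * (t' (?succ i) - t (?succ i)))\<bar>
          \<le> \<eta> / 3 * ?S"
        using \<rho>[of i, unfolded expansion_def, rule_format, OF _ near[rule_format, OF pred]
            near[rule_format, OF \<open>i < k\<close>] near[rule_format, OF succ]] \<open>i < k\<close> by simp
      then have "\<bar>cyclic_residual k a b c (\<lambda>j. t' j - t j) i\<bar> \<le> \<eta> / 3 * ?S"
        unfolding F_orbit[OF orbit' \<open>i < k\<close>] F_orbit[OF orbit \<open>i < k\<close>]
        by (simp only: diff_zero diff_0 abs_minus_cancel cyclic_residual_def)
      also have "\<dots> \<le> \<eta> / 3 * (3 * (\<Sum>j<k. \<bar>t' j - t j\<bar>))"
        using cyclic_neighbours_le_sum[OF \<open>i < k\<close>, of "\<lambda>j. t' j - t j"] \<open>0 < \<eta>\<close>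
        by (intro mult_left_mono) auto
      finally show "\<bar>cyclic_residual k a b c (\<lambda>j. t' j - t j) i\<bar> \<le> \<eta> * (\<Sum>j<k. \<bar>t' j - t j\<bar>)"
        by simp
    qed
  qed
qed

lemma periodic_orbit_tangent_hyperplane:
  fixes \<gamma> :: "nat \<Rightarrow> real \<Rightarrow> real^2" and t :: "nat \<Rightarrow> real"
  assumes orbit: "periodic_orbit k \<gamma> skew t" and odd: "odd (card {j. j < k \<and> skew j})"
    and tangent: "\<And>j. j < k \<Longrightarrow> (\<gamma> j has_vector_derivative vector_derivative (\<gamma> j) (at (t j))) (at (t j))"
    and curvature: "\<And>j. j < k \<Longrightarrow> (\<lambda>s. vector_derivative (\<gamma> j) (at s)) differentiable (at (t j))"
    and E: "\<And>t'. t' \<in> E \<Longrightarrow> periodic_orbit k \<gamma> skew t'"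
  shows "\<exists>q. q \<noteq> 0 \<and> (\<forall>\<eta>>0. \<exists>U. open U \<and> t \<in> U \<and>
    (\<forall>t'\<in>E \<inter> U. \<bar>q \<bullet> ((t' 0, t' 1) - (t 0, t 1))\<bar> \<le> \<eta> * norm ((t' 0, t' 1) - (t 0, t 1))))"
proof -
  define P where "P j = \<gamma> j (t j)" for j
  define V where "V j = vector_derivative (\<gamma> j) (at (t j))" for j
  define a where "a j = det2 (reflect_dir (V j) (V (cyclic_pred k j))) (P (cyclic_succ k j) - P j)" for j
  define c where "c j = det2 (reflect_dir (V j) (P (cyclic_pred k j) - P j)) (V (cyclic_succ k j))" for j
  have "3 \<le> k"
    using orbit odd by (rule periodic_orbit_three_le)
  have prod_neg: "(\<Prod>j<k. a j * c j) < 0"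
    using periodic_orbit_coefficient_product[OF orbit] odd \<open>3 \<le> k\<close>
    unfolding a_def c_def P_def V_def by simp
  have c_nonzero: "\<forall>i<k. c i \<noteq> 0" and "(\<Prod>i<k. a i / c i) < 0"
    using prod_divide_neg_if_prod_mult_neg[OF prod_neg] by auto
  then have monodromy: "(\<Prod>i<k. a i / c i) \<noteq> 1"
    by auto
  have "\<exists>b. \<forall>\<eta>>0. \<exists>\<rho>>0. \<forall>t'. periodic_orbit k \<gamma> skew t' \<longrightarrow> (\<forall>j<k. \<bar>t' j - t j\<bar> < \<rho>) \<longrightarrow>
      (\<forall>i<k. \<bar>cyclic_residual k a b c (\<lambda>j. t' j - t j) i\<bar> \<le> \<eta> * (\<Sum>j<k. \<bar>t' j - t j\<bar>))"
    unfolding a_def c_def P_def V_def using \<open>3 \<le> k\<close>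
    by (intro periodic_orbit_linearization orbit tangent curvature) auto
  then obtain b where b: "\<And>\<eta>. 0 < \<eta> \<Longrightarrow> \<exists>\<rho>>0. \<forall>t'. periodic_orbit k \<gamma> skew t' \<longrightarrow> (\<forall>j<k. \<bar>t' j - t j\<bar> < \<rho>) \<longrightarrow>
      (\<forall>i<k. \<bar>cyclic_residual k a b c (\<lambda>j. t' j - t j) i\<bar> \<le> \<eta> * (\<Sum>j<k. \<bar>t' j - t j\<bar>))"
    by blast
  obtain q where "q \<noteq> 0" and kernel: "\<And>\<epsilon>. 0 < \<epsilon> \<Longrightarrow> \<exists>\<eta>>0. \<forall>x.
      (\<forall>i<k. \<bar>cyclic_residual k a b c x i\<bar> \<le> \<eta> * (\<Sum>j<k. \<bar>x j\<bar>)) \<longrightarrow> \<bar>q \<bullet> (x 0, x 1)\<bar> \<le> \<epsilon> * (\<bar>x 0\<bar> + \<bar>x 1\<bar>)"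
  proof (rule cyclic_recurrence_near_kernel[where b=b, OF _ c_nonzero monodromy])
    show "2 \<le> k" using \<open>3 \<le> k\<close> by simp
  qed (rule that)
  show ?thesis
  proof (intro exI[of _ q] conjI allI impI \<open>q \<noteq> 0\<close>)
    fix \<eta> :: real assume "0 < \<eta>"
    then obtain \<eta>' where "0 < \<eta>'" and \<eta>': "\<And>x. \<forall>i<k. \<bar>cyclic_residual k a b c x i\<bar> \<le> \<eta>' * (\<Sum>j<k. \<bar>x j\<bar>) \<Longrightarrow>
        \<bar>q \<bullet> (x 0, x 1)\<bar> \<le> \<eta> / 2 * (\<bar>x 0\<bar> + \<bar>x 1\<bar>)"
      using kernel[of "\<eta> / 2"] by (meson half_gt_zero)
    obtain \<rho> where "0 < \<rho>" and \<rho>: "\<And>t'. periodic_orbit k \<gamma> skew t' \<Longrightarrow> \<forall>j<k. \<bar>t' j - t j\<bar> < \<rho> \<Longrightarrow>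
        \<forall>i<k. \<bar>cyclic_residual k a b c (\<lambda>j. t' j - t j) i\<bar> \<le> \<eta>' * (\<Sum>j<k. \<bar>t' j - t j\<bar>)"
      using b[OF \<open>0 < \<eta>'\<close>] by meson
    define U where "U = {t'. \<forall>j\<in>{..<k}. t' j \<in> ball (t j) \<rho>}"
    have "open U"
      unfolding U_def by (rule product_topology_basis'[where x="\<lambda>j. j", simplified]) auto
    moreover have "t \<in> U"
      using \<open>0 < \<rho>\<close> by (simp add: U_def)
    moreover have "\<bar>q \<bullet> ((t' 0, t' 1) - (t 0, t 1))\<bar> \<le> \<eta> * norm ((t' 0, t' 1) - (t 0, t 1))"
      if "t' \<in> E \<inter> U" for t'
    proof -
      have "\<forall>j<k. \<bar>t' j - t j\<bar> < \<rho>"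
        using that by (simp add: U_def dist_real_def abs_minus_commute)
      with that E have "\<forall>i<k. \<bar>cyclic_residual k a b c (\<lambda>j. t' j - t j) i\<bar> \<le> \<eta>' * (\<Sum>j<k. \<bar>t' j - t j\<bar>)"
        using \<rho> by blast
      then have "\<bar>q \<bullet> (t' 0 - t 0, t' 1 - t 1)\<bar> \<le> \<eta> / 2 * (\<bar>t' 0 - t 0\<bar> + \<bar>t' 1 - t 1\<bar>)"
        by (rule \<eta>')
      also have "\<dots> \<le> \<eta> / 2 * (2 * norm (t' 0 - t 0, t' 1 - t 1))"
        using norm_fst_le[of "t' 0 - t 0" "t' 1 - t 1"] norm_snd_le[of "t' 1 - t 1" "t' 0 - t 0"] \<open>0 < \<eta>\<close>
        by (intro mult_left_mono) simp_all
      finally show ?thesis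
        by simp
    qed
    ultimately show "\<exists>U. open U \<and> t \<in> U \<and> (\<forall>t'\<in>E \<inter> U.
        \<bar>q \<bullet> ((t' 0, t' 1) - (t 0, t 1))\<bar> \<le> \<eta> * norm ((t' 0, t' 1) - (t 0, t 1)))"
      by blast
  qed
qed

section \<open>Measure reflectivity\<close>

lemma C3_on_subset: "C3_on S \<gamma> \<Longrightarrow> T \<subseteq> S \<Longrightarrow> C3_on T \<gamma>"
  unfolding C3_on_def by (meson continuous_on_subset subsetD)

lemma C3_on_derivatives:
  assumes "C3_on S \<gamma>" "open S" "x \<in> S"
  shows "(\<gamma> has_vector_derivative vector_derivative \<gamma> (at x)) (at x)"
    and "(\<lambda>s. vector_derivative \<gamma> (at s)) differentiable (at x)"
proof -
  obtain \<gamma>1 \<gamma>2 where d1: "\<And>s. s \<in> S \<Longrightarrow> (\<gamma> has_vector_derivative \<gamma>1 s) (at s)"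
    and d2: "\<And>s. s \<in> S \<Longrightarrow> (\<gamma>1 has_vector_derivative \<gamma>2 s) (at s)"
    using assms(1) unfolding C3_on_def by blast
  have vd: "vector_derivative \<gamma> (at s) = \<gamma>1 s" if "s \<in> S" for s
    using d1[OF that] by (rule vector_derivative_at)
  show "(\<gamma> has_vector_derivative vector_derivative \<gamma> (at x)) (at x)"
    using d1[OF assms(3)] vd[OF assms(3)] by simp
  have "((\<lambda>s. vector_derivative \<gamma> (at s)) has_vector_derivative \<gamma>2 x) (at x)"
    by (rule has_vector_derivative_transform_within_open[OF d2[OF assms(3)] assms(2,3)]) (simp add: vd)
  then show "(\<lambda>s. vector_derivative \<gamma> (at s)) differentiable (at x)"
    by (rule differentiableI_vector)
qed

lemma curve_germs_common_radius:
  fixes k :: nat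
  assumes "\<forall>j<k. curve_germ (\<gamma> j)"
  obtains \<epsilon> :: real where "0 < \<epsilon>" "\<And>j. j < k \<Longrightarrow> C3_on {-\<epsilon><..<\<epsilon>} (\<gamma> j)"
proof (rule finite_common_radius[of "{..<k}" "\<lambda>j \<epsilon>. C3_on {-\<epsilon><..<\<epsilon>} (\<gamma> j)"])
  show "\<exists>\<epsilon>>0. C3_on {-\<epsilon><..<\<epsilon>} (\<gamma> j)" if "j \<in> {..<k}" for j
    using assms that by (simp add: curve_germ_def)
qed (auto elim: C3_on_subset intro: that)

theorem proposition5p9:
  fixes k :: nat and \<gamma> :: "nat \<Rightarrow> real \<Rightarrow> real^2" and skew :: "nat \<Rightarrow> bool"
  assumes "pseudo_billiard k \<gamma> skew"
    and "odd (card {j. j < k \<and> skew j})"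
  shows "\<not> measure_reflective k \<gamma> skew"
proof
  assume reflective: "measure_reflective k \<gamma> skew"
  obtain \<epsilon> :: real where "0 < \<epsilon>" and C3: "\<And>j. j < k \<Longrightarrow> C3_on {-\<epsilon><..<\<epsilon>} (\<gamma> j)"
    using assms(1) curve_germs_common_radius by (auto simp: pseudo_billiard_def)
  define E where "E = {t. (\<forall>j<k. t j \<in> {-\<epsilon><..<\<epsilon>}) \<and> periodic_orbit k \<gamma> skew t}"
  have "negligible ((\<lambda>t. (t 0, t 1)) ` E)"
  proof (rule negligible_image_if_tangent_to_hyperplanes)
    fix t assume "t \<in> E"
    then have orbit: "periodic_orbit k \<gamma> skew t" and t: "\<And>j. j < k \<Longrightarrow> t j \<in> {-\<epsilon><..<\<epsilon>}"
      by (auto simp: E_def)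
    show "\<exists>q. q \<noteq> 0 \<and> (\<forall>\<eta>>0. \<exists>U. open U \<and> t \<in> U \<and> (\<forall>t'\<in>E \<inter> U.
        \<bar>q \<bullet> ((t' 0, t' 1) - (t 0, t 1))\<bar> \<le> \<eta> * norm ((t' 0, t' 1) - (t 0, t 1))))"
    proof (rule periodic_orbit_tangent_hyperplane[OF orbit assms(2)])
      fix j assume "j < k"
      with t show "(\<gamma> j has_vector_derivative vector_derivative (\<gamma> j) (at (t j))) (at (t j))"
        and "(\<lambda>s. vector_derivative (\<gamma> j) (at s)) differentiable (at (t j))"
        using C3_on_derivatives[OF C3] by auto
    qed (auto simp: E_def)
  qed
  with reflective \<open>0 < \<epsilon>\<close> show False
    by (simp add: measure_reflective_def negligible_iff_null_sets E_def)
qed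

end
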